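(* Let $D$ be a division ring with infinite center and let $n\geq 2$. Then every matrix $a\in M_n(D)$ is a product of two commutators, that is, there exist $b,c,d,e\in M_n(D)$ with $a=[b,c][d,e]$.
   Context: The commutator of $x,y$ in a ring is the additive commutator $[x,y]=xy-yx$. Division rings are not assumed to be noncommutative or finite-dimensional over their centers. *)

theory Defs
  imports "Jordan_Normal_Form.Matrix"
begin

definition ring_center :: "'a :: ring set" where
  "ring_center = {z. \<forall>x. z * x = x * z}"

(* Stated over bare minus and times because the type of matrices of all dimensions
   is not a ring; on carrier_mat n n it is the commutator of the ring M_n. *)
definition commutator :: "'a :: {minus, times} \<Rightarrow> 'a \<Rightarrow> 'a" where
  "commutator x y = x * y - y * x"

end

(* If a is not a central scalar, some conjugate of a by a transvection has a nonzero entry below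
   the diagonal in its first column. The Bruhat decomposition U' P T of that conjugate (U', T upper
   triangular, P a permutation matrix moving 0) is in turn conjugate to P V with V = T U' upper
   triangular. Write V = D y with D diagonal and y upper triangular of trace zero. For a suitable
   transvection Q, the factor Q^-1 y is again upper triangular of trace zero, hence a commutator with
   the upper shift, while the nonzero diagonal entries of P D Q, at the fixed points of P and at one
   further index, have sum zero. The matrix P D Q is the commutator of some b that is a shift on the
   indices of these entries and has distinct central eigenvalues elsewhere; this is where the
   infinite center is used. A central scalar is the product of a cyclic permutation matrix and a
   multiple of its inverse, both with zero diagonal. *)

theory Submission
  imports Defs "HOL-Combinatorics.Permutations"
begin

section \<open>The ring of column-finite matrices\<close>

text \<open>The matrices of all sizes embed into this unital ring, in which invertible matrices of a given
  size are completed by ones on the diagonal.\<close>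

typedef (overloaded) 'a cfmat = "{A :: nat \<Rightarrow> nat \<Rightarrow> 'a::ring_1. \<forall>j. finite {i. A i j \<noteq> 0}}"
  morphisms ent Abs_cfmat
  by (rule exI[of _ "\<lambda>i j. 0"]) simp

setup_lifting type_definition_cfmat

lemma finite_ent: "finite {i. ent A i j \<noteq> 0}"
  using ent[of A] by simp

lemma cfmat_eqI: "(\<And>i j. ent A i j = ent B i j) \<Longrightarrow> A = B"
  by (metis ent_inject ext)

instantiation cfmat :: (ring_1) ring_1
begin

lift_definition zero_cfmat :: "'a cfmat" is "\<lambda>i j. 0" by simp

lift_definition one_cfmat :: "'a cfmat" is "\<lambda>i j. if i = j then 1 else 0" by simp

lift_definition plus_cfmat :: "'a cfmat \<Rightarrow> 'a cfmat \<Rightarrow> 'a cfmat" is "\<lambda>A B i j. A i j + B i j"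
proof -
  fix A B :: "nat \<Rightarrow> nat \<Rightarrow> 'a" and j
  assume "\<And>j. finite {i. A i j \<noteq> 0}" "\<And>j. finite {i. B i j \<noteq> 0}"
  then have "finite ({i. A i j \<noteq> 0} \<union> {i. B i j \<noteq> 0})"
    by blast
  then show "finite {i. A i j + B i j \<noteq> 0}"
    by (rule rev_finite_subset) auto
qed

lift_definition uminus_cfmat :: "'a cfmat \<Rightarrow> 'a cfmat" is "\<lambda>A i j. - A i j" by simp

lift_definition minus_cfmat :: "'a cfmat \<Rightarrow> 'a cfmat \<Rightarrow> 'a cfmat" is "\<lambda>A B i j. A i j - B i j"
proof -
  fix A B :: "nat \<Rightarrow> nat \<Rightarrow> 'a" and j
  assume "\<And>j. finite {i. A i j \<noteq> 0}" "\<And>j. finite {i. B i j \<noteq> 0}"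
  then have "finite ({i. A i j \<noteq> 0} \<union> {i. B i j \<noteq> 0})"
    by blast
  then show "finite {i. A i j - B i j \<noteq> 0}"
    by (rule rev_finite_subset) auto
qed

text \<open>Rows may be infinite, so the sum runs over the finite support of a column of the right
  factor.\<close>

lift_definition times_cfmat :: "'a cfmat \<Rightarrow> 'a cfmat \<Rightarrow> 'a cfmat"
  is "\<lambda>A B i j. \<Sum>k | B k j \<noteq> 0. A i k * B k j"
proof -
  fix A B :: "nat \<Rightarrow> nat \<Rightarrow> 'a" and j
  assume fin: "\<And>j. finite {i. A i j \<noteq> 0}" "\<And>j. finite {i. B i j \<noteq> 0}"
  have "{i. (\<Sum>k | B k j \<noteq> 0. A i k * B k j) \<noteq> 0} \<subseteq> (\<Union>k\<in>{k. B k j \<noteq> 0}. {i. A i k \<noteq> 0})"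
  proof
    fix i assume "i \<in> {i. (\<Sum>k | B k j \<noteq> 0. A i k * B k j) \<noteq> 0}"
    then obtain k where "B k j \<noteq> 0" "A i k * B k j \<noteq> 0"
      by (metis (mono_tags, lifting) mem_Collect_eq sum.neutral)
    then have "A i k \<noteq> 0"
      by (metis mult_zero_left)
    with \<open>B k j \<noteq> 0\<close> show "i \<in> (\<Union>k\<in>{k. B k j \<noteq> 0}. {i. A i k \<noteq> 0})"
      by blast
  qed
  moreover have "finite (\<Union>k\<in>{k. B k j \<noteq> 0}. {i. A i k \<noteq> 0})"
    using fin by blast
  ultimately show "finite {i. (\<Sum>k | B k j \<noteq> 0. A i k * B k j) \<noteq> 0}"
    by (rule finite_subset)
qed

lemma ent_mult_superset:
  assumes "finite K" "\<And>k. ent B k j \<noteq> 0 \<Longrightarrow> k \<in> K"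
  shows "ent (A * B) i j = (\<Sum>k\<in>K. ent A i k * ent B k j)"
  unfolding times_cfmat.rep_eq using assms by (intro sum.mono_neutral_left) auto

instance
proof
  fix A B C :: "'a cfmat"
  show "A * B * C = A * (B * C)"
  proof (rule cfmat_eqI)
    fix i j
    define K where "K = {k. ent C k j \<noteq> 0}"
    define L where "L = (\<Union>k\<in>K. {l. ent B l k \<noteq> 0})"
    have fin: "finite K" "finite L"
      unfolding K_def L_def by (auto simp: finite_ent)
    have L: "ent (A * B) i k = (\<Sum>l\<in>L. ent A i l * ent B l k)" if "k \<in> K" for i k
      using that fin by (intro ent_mult_superset) (auto simp: L_def)
    have BC: "ent (B * C) l j = (\<Sum>k\<in>K. ent B l k * ent C k j)" for l
      using fin by (intro ent_mult_superset) (auto simp: K_def)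
    have "ent (A * B * C) i j = (\<Sum>k\<in>K. ent (A * B) i k * ent C k j)"
      using fin by (intro ent_mult_superset) (auto simp: K_def)
    also have "\<dots> = (\<Sum>k\<in>K. \<Sum>l\<in>L. ent A i l * ent B l k * ent C k j)"
      by (simp add: L sum_distrib_right)
    also have "\<dots> = (\<Sum>l\<in>L. \<Sum>k\<in>K. ent A i l * ent B l k * ent C k j)"
      by (rule sum.swap)
    also have "\<dots> = (\<Sum>l\<in>L. ent A i l * ent (B * C) l j)"
      by (simp add: BC sum_distrib_left mult.assoc)
    also have "\<dots> = ent (A * (B * C)) i j"
    proof (rule ent_mult_superset[symmetric])
      fix l assume "ent (B * C) l j \<noteq> 0"
      then obtain k where "k \<in> K" "ent B l k * ent C k j \<noteq> 0"
        unfolding BC by (metis (mono_tags, lifting) sum.neutral)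
      then have "ent B l k \<noteq> 0"
        by (metis mult_zero_left)
      with \<open>k \<in> K\<close> show "l \<in> L"
        by (auto simp: L_def)
    qed (use fin in auto)
    finally show "ent (A * B * C) i j = ent (A * (B * C)) i j" .
  qed
  show "(A + B) * C = A * C + B * C"
    by (rule cfmat_eqI) (simp add: times_cfmat.rep_eq plus_cfmat.rep_eq distrib_right sum.distrib)
  show "A * (B + C) = A * B + A * C"
  proof (rule cfmat_eqI)
    fix i j
    define K where "K = {k. ent B k j \<noteq> 0} \<union> {k. ent C k j \<noteq> 0}"
    have K: "ent (A * X) i j = (\<Sum>k\<in>K. ent A i k * ent X k j)" if "X \<in> {B, C, B + C}" for X
      using that by (intro ent_mult_superset) (auto simp: K_def finite_ent plus_cfmat.rep_eq)
    show "ent (A * (B + C)) i j = ent (A * B + A * C) i j"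
      by (simp add: K plus_cfmat.rep_eq distrib_left sum.distrib)
  qed
  show "1 * A = A"
  proof (rule cfmat_eqI)
    fix i j
    have "ent (1 * A) i j = (\<Sum>k\<in>{k. ent A k j \<noteq> 0} \<union> {i}. ent 1 i k * ent A k j)"
      by (intro ent_mult_superset) (auto simp: finite_ent)
    also have "\<dots> = (\<Sum>k\<in>{i}. ent 1 i k * ent A k j)"
      by (rule sum.mono_neutral_right) (auto simp: finite_ent one_cfmat.rep_eq)
    finally show "ent (1 * A) i j = ent A i j"
      by (simp add: one_cfmat.rep_eq)
  qed
  show "A * 1 = A"
  proof (rule cfmat_eqI)
    fix i j
    have "ent (A * 1) i j = (\<Sum>k\<in>{j}. ent A i k * ent 1 k j)"
      by (intro ent_mult_superset) (auto simp: one_cfmat.rep_eq split: if_splits)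
    then show "ent (A * 1) i j = ent A i j"
      by (simp add: one_cfmat.rep_eq)
  qed
  have "ent (0 :: 'a cfmat) 0 0 \<noteq> ent 1 0 0"
    by (simp add: zero_cfmat.rep_eq one_cfmat.rep_eq)
  then show "(0 :: 'a cfmat) \<noteq> 1"
    by metis
qed (auto intro!: cfmat_eqI simp: plus_cfmat.rep_eq zero_cfmat.rep_eq minus_cfmat.rep_eq
      uminus_cfmat.rep_eq add.assoc add.commute)

end

lemmas ent_simps [simp] =
  zero_cfmat.rep_eq one_cfmat.rep_eq plus_cfmat.rep_eq minus_cfmat.rep_eq uminus_cfmat.rep_eq

lemma ent_mult_left:
  assumes "finite K" "\<And>k. ent A i k \<noteq> 0 \<Longrightarrow> k \<in> K"
  shows "ent (A * B) i j = (\<Sum>k\<in>K. ent A i k * ent B k j)"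
proof -
  have "ent (A * B) i j = (\<Sum>k\<in>{k. ent B k j \<noteq> 0} \<union> K. ent A i k * ent B k j)"
    using assms by (intro ent_mult_superset) (auto simp: finite_ent)
  also have "\<dots> = (\<Sum>k\<in>K. ent A i k * ent B k j)"
  proof (rule sum.mono_neutral_right)
    show "\<forall>k\<in>{k. ent B k j \<noteq> 0} \<union> K - K. ent A i k * ent B k j = 0"
      using assms(2) mult_zero_left by (metis Diff_iff)
  qed (use assms(1) in \<open>auto simp: finite_ent\<close>)
  finally show ?thesis .
qed

section \<open>Matrix units, diagonal matrices and permutation matrices\<close>

lift_definition el :: "'a \<Rightarrow> nat \<Rightarrow> nat \<Rightarrow> 'a::ring_1 cfmat"
  is "\<lambda>s a b i j. if i = a \<and> j = b then s else 0"
  by simp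

lift_definition diagm :: "(nat \<Rightarrow> 'a) \<Rightarrow> 'a::ring_1 cfmat"
  is "\<lambda>d i j. if i = j then d i else 0"
  by simp

lift_definition permm :: "(nat \<Rightarrow> nat) \<Rightarrow> 'a::ring_1 cfmat"
  is "\<lambda>p i j. if i = p j then 1 else 0"
  by simp

abbreviation scm :: "'a \<Rightarrow> 'a::ring_1 cfmat" where
  "scm z \<equiv> diagm (\<lambda>_. z)"

abbreviation idm :: "nat set \<Rightarrow> 'a::ring_1 cfmat" where
  "idm I \<equiv> diagm (\<lambda>i. if i \<in> I then 1 else 0)"

lemmas [simp] = el.rep_eq diagm.rep_eq permm.rep_eq

lemma ent_el_mult [simp]: "ent (el s a b * A) i j = (if i = a then s * ent A b j else 0)"
  by (subst ent_mult_left[where K = "{b}"]) (auto split: if_splits)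

lemma ent_mult_el [simp]: "ent (A * el s a b) i j = (if j = b then ent A i a * s else 0)"
  by (subst ent_mult_superset[where K = "{a}"]) (auto split: if_splits)

lemma ent_diagm_mult [simp]: "ent (diagm d * A) i j = d i * ent A i j"
  by (subst ent_mult_left[where K = "{i}"]) (auto split: if_splits)

lemma ent_mult_diagm [simp]: "ent (A * diagm d) i j = ent A i j * d j"
  by (subst ent_mult_superset[where K = "{j}"]) (auto split: if_splits)

lemma ent_mult_permm [simp]: "ent (A * permm p) i j = ent A i (p j)"
  by (subst ent_mult_superset[where K = "{p j}"]) (auto split: if_splits)

lemma ent_permm_mult [simp]:
  assumes "inj p"
  shows "ent (permm p * A) (p i) j = ent A i j"
proof -
  have "ent (permm p * A) (p i) j = (\<Sum>k\<in>{i}. ent (permm p) (p i) k * ent A k j)"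
    using assms by (intro ent_mult_left) (auto dest: injD split: if_splits)
  then show ?thesis
    by simp
qed

lemma el_mult_el: "el s a b * el t c d = (if b = c then el (s * t) a d else 0)"
  by (rule cfmat_eqI) auto

lemma scm_commutes: "z \<in> ring_center \<Longrightarrow> scm z * A = A * scm z"
  by (rule cfmat_eqI) (simp add: ring_center_def)

section \<open>Commutators on finite index sets\<close>

definition supported :: "nat set \<Rightarrow> 'a::ring_1 cfmat \<Rightarrow> bool" where
  "supported I A \<longleftrightarrow> (\<forall>i j. i \<notin> I \<or> j \<notin> I \<longrightarrow> ent A i j = 0)"

text \<open>Recasts a condition on entries as membership in the corner cut out by
  \<open>idm I\<close>, so that closure properties become ring identities.\<close>

lemma supported_iff: "supported I A \<longleftrightarrow> idm I * A = A \<and> A * idm I = A"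
proof
  assume "supported I A"
  then show "idm I * A = A \<and> A * idm I = A"
    by (auto simp: supported_def intro!: cfmat_eqI)
next
  assume *: "idm I * A = A \<and> A * idm I = A"
  show "supported I A"
    unfolding supported_def
  proof (intro allI impI)
    fix i j assume "i \<notin> I \<or> j \<notin> I"
    moreover have "ent (idm I * A) i j = ent A i j" "ent (A * idm I) i j = ent A i j"
      by (simp_all only: *)
    ultimately show "ent A i j = 0"
      by (auto simp del: ent_simps)
  qed
qed

lemma supported_mult: "supported I A \<Longrightarrow> supported I B \<Longrightarrow> supported I (A * B)"
  unfolding supported_iff by (metis mult.assoc)

lemma supported_diff: "supported I A \<Longrightarrow> supported I B \<Longrightarrow> supported I (A - B)"
  unfolding supported_def by (metis diff_0_right ent_simps(4))

lemma supported_commutator: "supported I A \<Longrightarrow> supported I B \<Longrightarrow> supported I (commutator A B)"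
  unfolding commutator_def by (intro supported_diff supported_mult)

text \<open>The condition makes \<open>y \<mapsto> b y - y z\<close> invertible for almost all central \<open>z\<close>, so that the
  off-diagonal part of a matrix bordered by a zero diagonal entry can be solved for.\<close>

definition good :: "'a::ring_1 cfmat \<Rightarrow> bool" where
  "good b \<longleftrightarrow> (\<exists>Z. finite Z \<and>
     (\<forall>z\<in>ring_center - Z. \<exists>r. r * (b - scm z) = 1 \<and> (b - scm z) * r = 1))"

definition good_commutator :: "nat set \<Rightarrow> 'a::ring_1 cfmat \<Rightarrow> bool" where
  "good_commutator I x \<longleftrightarrow>
     (\<exists>b c. supported I b \<and> supported I c \<and> good b \<and> x = commutator b c)"

section \<open>Enlarging the index set by zero diagonal entries\<close>

lemma inverse_commutes:
  fixes e t r :: "'a::monoid_mult"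
  assumes "e * t = t * e" "r * t = 1" "t * r = 1"
  shows "e * r = r * e"
  by (metis assms mult.assoc mult.left_neutral mult.right_neutral)

lemma ring_centerD: "z \<in> ring_center \<Longrightarrow> x * z = z * x"
  unfolding ring_center_def by (drule CollectD) (erule allE, erule sym)

lemma ring_centerI: "(\<And>x. x * z = z * x) \<Longrightarrow> z \<in> ring_center"
  unfolding ring_center_def by (rule CollectI, rule allI, rule sym)

lemma ring_center_inverse:
  fixes z :: "'a::division_ring"
  assumes "z \<in> ring_center"
  shows "inverse z \<in> ring_center"
proof (cases "z = 0")
  case False
  show ?thesis
  proof (rule ring_centerI)
    fix x
    show "x * inverse z = inverse z * x"
      by (rule inverse_commutes[OF ring_centerD[OF assms] left_inverse[OF False]
            right_inverse[OF False]])
  qed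
qed (use assms in simp)

lemma ring_center_diff: "z \<in> ring_center \<Longrightarrow> w \<in> ring_center \<Longrightarrow> z - w \<in> ring_center"
  by (rule ring_centerI) (simp only: left_diff_distrib right_diff_distrib ring_centerD[of z]
      ring_centerD[of w])

text \<open>In the Peirce decomposition for \<open>E\<close> and \<open>e\<close>, the first
  argument is block diagonal with blocks \<open>b\<close> and \<open>w\<close>. Its commutators with
  the two off-diagonal corrections amount to multiplication by \<open>b - w\<close> on the left or
  on the right, which \<open>r\<close> undoes.\<close>

lemma corner_extension_commutator:
  fixes E e b c x r w :: "'a::ring_1"
  assumes E: "e * E = 0" "E * e = 0" "e * e = e"
    and b: "e * b = 0" "b * e = 0" and c: "e * c = 0" "c * e = 0"
    and w: "\<And>y. w * y = y * w"
    and r: "r * (b - w) = 1" "(b - w) * r = 1" "E * r = r * E"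
    and bc: "b * c - c * b = E * x * E"
  shows "commutator (b + w * e) (c + r * E * x * e - e * x * E * r)
     = E * x * E + E * x * e + e * x * E"
proof -
  define p where "p = r * E * x * e"
  define q where "q = e * x * E * r"
  have "(b - w) * p = E * x * e"
    unfolding p_def using r(2) by (simp flip: mult.assoc)
  then have bp: "b * p = E * x * e + w * p"
    by (simp add: algebra_simps)
  have "q * (b - w) = e * x * E"
    unfolding q_def using r(1) by (simp add: mult.assoc)
  then have qb: "q * b = e * x * E + q * w"
    by (simp add: algebra_simps)
  have pe: "p * e = p" "e * q = q"
    unfolding p_def q_def using E(3) by (simp_all add: mult.assoc) (simp flip: mult.assoc)
  have bq: "b * q = 0" "p * b = 0"
    unfolding p_def q_def using b by (simp_all add: mult.assoc) (simp flip: mult.assoc)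
  have "e * p = e * (E * r) * x * e"
    unfolding p_def r(3) by (simp add: mult.assoc)
  then have ep: "e * p = 0"
    using E(1) by (simp flip: mult.assoc)
  have "q * e = e * x * (r * E) * e"
    unfolding q_def by (simp add: mult.assoc flip: r(3))
  then have qe: "q * e = 0"
    using E(2) by (simp add: mult.assoc)
  have "commutator (b + w * e) (c + p - q)
      = b * c - c * b + b * p - b * q + w * (e * c) + w * (e * p) - w * (e * q)
        - (c * (w * e) + p * b + p * (w * e) - q * b - q * (w * e))"
    by (simp add: commutator_def algebra_simps)
  also have "c * (w * e) = w * (c * e)"
    by (metis mult.assoc w)
  also have "p * (w * e) = w * (p * e)"
    by (metis mult.assoc w)
  also have "q * (w * e) = w * (q * e)"
    by (metis mult.assoc w)
  finally show ?thesis
    unfolding bp qb pe bq ep qe c bc p_def[symmetric] q_def[symmetric] using w[of q] by simp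
qed

text \<open>Off \<open>e\<close> the element acts as \<open>b - w'\<close>, on \<open>e\<close> as
  \<open>w - w'\<close>; the inverse is glued from the inverses \<open>r\<close> and
  \<open>k\<close> of the two blocks.\<close>

lemma corner_extension_inverse:
  fixes e b r w w' k :: "'a::ring_1"
  assumes e: "e * e = e" and b: "e * b = 0" "b * e = 0"
    and w: "\<And>y. w * y = y * w" "\<And>y. w' * y = y * w'" "\<And>y. k * y = y * k"
    and k: "k * (w - w') = 1"
    and r: "r * (b - w') = 1" "(b - w') * r = 1"
  shows "(r * (1 - e) + k * e) * (b + w * e - w') = 1"
    and "(b + w * e - w') * (r * (1 - e) + k * e) = 1"
proof -
  have er: "e * r = r * e"
    by (rule inverse_commutes[OF _ r]) (simp add: algebra_simps b w(2))
  have re: "r * e * b = 0" "b * r * e = 0"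
    using b er by (metis mult.assoc mult_zero_right, metis mult.assoc mult_zero_left er b)
  \<comment> \<open>As \<open>b\<close> kills \<open>r * e\<close>, the equation
    \<open>(b - w') * r = 1\<close> says that \<open>r\<close> inverts \<open>- w'\<close> on the
    corner of \<open>e\<close>.\<close>
  have we: "- (w' * (r * e)) = e"
    using r(2) re(2) by (metis add_0 add.commute diff_0 left_diff_distrib mult.assoc mult_1)
  have split: "b + w * e - w' = (b - w') + w * e"
    by simp
  have te: "(b - w') * e = - (w' * e)" "e * (b - w') = - (w' * e)"
    using b by (simp_all add: algebra_simps w(2))
  have ewe: "e * (w * e) = w * e"
    by (metis e mult.assoc w(1))
  have "(r * (1 - e) + k * e) * (b + w * e - w')
      = r * (b - w') - r * (e * (b - w')) + k * (e * (b - w')) + r * (w * e)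
        - r * (e * (w * e)) + k * (e * (w * e))"
    unfolding split by (simp add: algebra_simps)
  also have "\<dots> = 1 + r * (w' * e) + k * (w - w') * e"
    unfolding te ewe r by (simp add: algebra_simps)
  also have "r * (w' * e) = - e"
    by (metis add.inverse_inverse mult.assoc w(2) we)
  finally show "(r * (1 - e) + k * e) * (b + w * e - w') = 1"
    by (simp add: k)
  have "(b + w * e - w') * (r * (1 - e) + k * e)
      = (b - w') * r - (b - w') * r * e + (b - w') * (k * e) + w * (e * r) - w * (e * r) * e
        + w * e * (k * e)"
    unfolding split by (simp add: algebra_simps)
  also have "(b - w') * (k * e) = k * ((b - w') * e)"
    by (metis mult.assoc w(3))
  also have "w * e * (k * e) = k * w * e"
    by (metis e mult.assoc w(3))
  also have "w * (e * r) * e = w * (e * r)"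
    by (metis e er mult.assoc)
  also have "(b - w') * r - (b - w') * r * e + k * ((b - w') * e) + w * (e * r) - w * (e * r) + k * w * e
     = 1 - e + k * (w - w') * e"
    unfolding te r by (simp add: algebra_simps)
  finally show "(b + w * e - w') * (r * (1 - e) + k * e) = 1"
    by (simp add: k)
qed

text \<open>A new central eigenvalue \<open>z\<close> at \<open>i\<close> makes the row and column
  of \<open>i\<close> solvable by \<open>corner_extension_commutator\<close>; the vanishing diagonal
  entry is the one block which that lemma cannot produce.\<close>

lemma good_commutator_insert:
  fixes x :: "'a::division_ring cfmat"
  assumes inf: "infinite (ring_center :: 'a set)"
    and i: "i \<notin> I" and x: "supported (insert i I) x" "ent x i i = 0"
    and I: "good_commutator I (idm I * x * idm I)"
  shows "good_commutator (insert i I) x"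
proof -
  let ?E = "idm I :: 'a cfmat" and ?e = "el 1 i i :: 'a cfmat"
  obtain b c Z where b: "supported I b" and c: "supported I c" and fin: "finite Z"
    and Z: "\<And>z. z \<in> ring_center - Z \<Longrightarrow> \<exists>r. r * (b - scm z) = 1 \<and> (b - scm z) * r = 1"
    and bc: "?E * x * ?E = b * c - c * b"
    using I unfolding good_commutator_def good_def commutator_def by metis
  \<comment> \<open>An infinite center leaves a value outside the finite exceptional set, so
    \<open>b - scm z\<close> is invertible.\<close>
  obtain z where z: "z \<in> ring_center" "z \<notin> Z"
    by (meson fin inf finite_subset subsetI)
  obtain r where r: "r * (b - scm z) = 1" "(b - scm z) * r = 1"
    using Z z by blast
  have ring: "?e * ?E = 0" "?E * ?e = 0" "?e * ?e = ?e"
    using i by (auto intro!: cfmat_eqI)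
  have be: "?e * y = 0" "y * ?e = 0" if "supported I y" for y
    using that i unfolding supported_def by (auto intro!: cfmat_eqI)
  have Er: "?E * r = r * ?E"
    using b unfolding supported_iff
    by (intro inverse_commutes[OF _ r]) (simp add: algebra_simps scm_commutes[OF z(1)])
  have "commutator (b + scm z * ?e) (c + r * ?E * x * ?e - ?e * x * ?E * r)
     = ?E * x * ?E + ?E * x * ?e + ?e * x * ?E"
    by (rule corner_extension_commutator) (simp_all add: ring be b c scm_commutes[OF z(1)] r Er bc)
  also have "\<dots> = x"
    using x i by (intro cfmat_eqI) (auto simp: supported_def)
  finally have "x = commutator (b + scm z * ?e) (c + r * ?E * x * ?e - ?e * x * ?E * r)" ..
  moreover have "supported (insert i I) (b + scm z * ?e)"
    using b by (auto simp: supported_def)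
  moreover have "supported (insert i I) (c + r * ?E * x * ?e - ?e * x * ?E * r)"
  proof -
    have "r * ?E * x * ?e = ?E * (r * x) * ?e" "?e * x * ?E * r = ?e * (x * r) * ?E"
      by (simp_all add: mult.assoc Er) (simp add: Er flip: mult.assoc)
    with c show ?thesis
      by (auto simp: supported_def split: if_splits)
  qed
  moreover have "good (b + scm z * ?e)"
    unfolding good_def
  proof (intro exI[of _ "insert z Z"] conjI ballI)
    show "finite (insert z Z)"
      using fin by simp
    fix z' assume z': "z' \<in> ring_center - insert z Z"
    then obtain r' where r': "r' * (b - scm z') = 1" "(b - scm z') * r' = 1"
      using Z by blast
    have k: "inverse (z - z') \<in> ring_center"
      using z z' by (simp add: ring_center_diff ring_center_inverse)
    have kz: "scm (inverse (z - z')) * (scm z - scm z') = 1"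
      using z' left_inverse[of "z - z'"] by (intro cfmat_eqI) (cases "z = z'"; simp)
    have "(r' * (1 - ?e) + scm (inverse (z - z')) * ?e) * (b + scm z * ?e - scm z') = 1"
      "(b + scm z * ?e - scm z') * (r' * (1 - ?e) + scm (inverse (z - z')) * ?e) = 1"
      using z z' k by (intro corner_extension_inverse; simp add: ring be b r' kz scm_commutes)+
    then show "\<exists>r. r * (b + scm z * ?e - scm z') = 1 \<and> (b + scm z * ?e - scm z') * r = 1"
      by blast
  qed
  ultimately show ?thesis
    unfolding good_commutator_def by blast
qed

text \<open>Indices of \<open>T\<close> are adjoined one at a time, with the matrix cut down to the
  indices treated so far.\<close>

lemma good_commutator_zero_diag_extension:
  fixes x :: "'a::division_ring cfmat"
  assumes inf: "infinite (ring_center :: 'a set)"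
    and T: "finite T" "S \<inter> T = {}"
    and x: "supported (S \<union> T) x" "\<And>i. i \<in> T \<Longrightarrow> ent x i i = 0"
    and S: "good_commutator S (idm S * x * idm S)"
  shows "good_commutator (S \<union> T) x"
  using T x S
proof (induction T arbitrary: x rule: finite_induct)
  case empty
  then show ?case
    by (metis mult.assoc sup_bot_right supported_iff)
next
  case (insert i T)
  let ?x = "idm (S \<union> T) * x * idm (S \<union> T)"
  have "idm S * ?x * idm S = idm S * x * idm S"
    by (rule cfmat_eqI) simp
  moreover have "supported (S \<union> T) ?x"
    by (simp add: supported_def)
  ultimately have "good_commutator (S \<union> T) ?x"
    using insert.prems by (intro insert.IH) auto
  then show ?case
    using good_commutator_insert[OF inf, of i "S \<union> T" x] insert by simp
qed

section \<open>Diagonal matrices of trace zero\<close>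

lemma good_0: "good (0 :: 'a::division_ring cfmat)"
  unfolding good_def
proof (intro exI[of _ "{0}"] conjI ballI)
  fix z :: 'a assume "z \<in> ring_center - {0}"
  then have "scm (- inverse z) * (0 - scm z) = 1 \<and> (0 - scm z) * scm (- inverse z) = 1"
    by (auto intro!: cfmat_eqI)
  then show "\<exists>r. r * (0 - scm z) = 1 \<and> (0 - scm z) * r = 1" ..
qed simp

text \<open>The inverse \<open>r\<close> of \<open>b - scm z\<close> commutes with
  \<open>idm S\<close>, so \<open>ent r i m = 0\<close> and \<open>?f * r * ?f = 0\<close>; the
  Neumann series for the perturbation by \<open>?f\<close> therefore stops at
  \<open>r - r * ?f * r\<close>.\<close>

lemma good_add_el:
  fixes b :: "'a::division_ring cfmat"
  assumes "supported S b" "m \<in> S" "i \<notin> S" "good b"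
  shows "good (b + el 1 m i)"
proof -
  let ?f = "el 1 m i :: 'a cfmat"
  obtain Z where Z: "finite Z"
    "\<And>z. z \<in> ring_center - Z \<Longrightarrow> \<exists>r. r * (b - scm z) = 1 \<and> (b - scm z) * r = 1"
    using assms(4) unfolding good_def by blast
  have "\<exists>r. r * (b + ?f - scm z) = 1 \<and> (b + ?f - scm z) * r = 1"
    if z: "z \<in> ring_center - Z" for z
  proof -
    obtain r where r: "r * (b - scm z) = 1" "(b - scm z) * r = 1"
      using Z z by blast
    have "idm S * r = r * idm S"
      using assms(1) z unfolding supported_iff
      by (intro inverse_commutes[OF _ r]) (simp add: algebra_simps scm_commutes)
    then have "ent (idm S * r) i m = ent (r * idm S) i m"
      by (simp only:)
    then have rim: "ent r i m = 0"
      using assms(2,3) by simp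
    have frf: "?f * r * ?f = 0"
      by (rule cfmat_eqI) (simp add: rim)
    then have frfr: "?f * (r * (?f * r)) = 0"
      by (metis mult.assoc mult_zero_left)
    have split: "b + ?f - scm z = (b - scm z) + ?f"
      by simp
    have "(r - r * ?f * r) * (b + ?f - scm z)
        = r * (b - scm z) + r * ?f - r * ?f * (r * (b - scm z)) - r * (?f * r * ?f)"
      unfolding split by (simp add: algebra_simps)
    moreover have "(b + ?f - scm z) * (r - r * ?f * r)
        = (b - scm z) * r + ?f * r - (b - scm z) * r * ?f * r - ?f * r * ?f * r"
      unfolding split by (simp add: algebra_simps)
    ultimately show ?thesis
      using frf frfr r by (intro exI[of _ "r - r * ?f * r"]) (simp add: mult.assoc)
  qed
  with Z(1) show ?thesis
    unfolding good_def by blast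
qed

text \<open>Along a path through \<open>S\<close>, \<open>b\<close> is a shift and \<open>c\<close>
  carries the partial sums of \<open>t\<close>, which pushes the accumulated trace to the latest
  index \<open>m\<close>. The zero row of \<open>b\<close> and the zero column of \<open>c\<close>
  at \<open>m\<close> keep the next step free of cross terms.\<close>

lemma diag_minus_trace_commutator:
  fixes t :: "nat \<Rightarrow> 'a::division_ring"
  assumes "finite S" "S \<noteq> {}"
  shows "\<exists>m\<in>S. \<exists>b c. supported S b \<and> supported S c \<and> good b \<and>
    (\<forall>j. ent b m j = 0) \<and> (\<forall>j. ent c j m = 0) \<and>
    commutator b c = diagm (\<lambda>i. if i \<in> S then t i else 0) - el (sum t S) m m"
  using assms
proof (induction S rule: finite_ne_induct)
  case (singleton m)
  have "commutator 0 0 = diagm (\<lambda>i. if i \<in> {m} then t i else 0) - el (sum t {m}) m m"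
    by (rule cfmat_eqI) (auto simp: commutator_def)
  then show ?case
    by (intro bexI[of _ m] exI[of _ 0]) (simp_all add: supported_def good_0)
next
  case (insert i S)
  obtain m b c where m: "m \<in> S" and bc: "supported S b" "supported S c" "good b"
    and b0: "\<And>j. ent b m j = 0" and c0: "\<And>j. ent c j m = 0"
    and comm: "commutator b c = diagm (\<lambda>i. if i \<in> S then t i else 0) - el (sum t S) m m"
    using insert.IH by blast
  let ?b = "b + el 1 m i" and ?c = "c + el (sum t S) i m"
  have im: "i \<noteq> m"
    using insert.hyps m by auto
  have bi: "ent b j i = 0" "ent c i j = 0" for j
    using bc insert.hyps by (auto simp: supported_def)
  have "b * el (sum t S) i m = 0" "el 1 m i * c = 0" "c * el 1 m i = 0" "el (sum t S) i m * b = 0"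
    using bi b0 c0 by (auto intro!: cfmat_eqI)
  then have "commutator ?b ?c = commutator b c + el (sum t S) m m - el (sum t S) i i"
    by (simp add: commutator_def algebra_simps el_mult_el)
  also have "\<dots> = diagm (\<lambda>j. if j \<in> insert i S then t j else 0) - el (sum t (insert i S)) i i"
    unfolding comm using insert.hyps im by (intro cfmat_eqI) auto
  finally have "commutator ?b ?c
      = diagm (\<lambda>j. if j \<in> insert i S then t j else 0) - el (sum t (insert i S)) i i" .
  moreover have "supported (insert i S) ?b" "supported (insert i S) ?c"
    using bc m by (auto simp: supported_def)
  moreover have "good ?b"
    using bc m insert.hyps by (intro good_add_el)
  moreover have "ent ?b i j = 0" "ent ?c j i = 0" for j
    using bc im insert.hyps by (auto simp: supported_def)
  ultimately show ?case
    by blast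
qed

lemma diag_trace_zero_good_commutator:
  fixes t :: "nat \<Rightarrow> 'a::division_ring"
  assumes "finite S" "sum t S = 0"
  shows "good_commutator S (diagm (\<lambda>i. if i \<in> S then t i else 0))"
proof (cases "S = {}")
  case True
  then have "diagm (\<lambda>i. if i \<in> S then t i else 0) = commutator 0 0"
    by (intro cfmat_eqI) (simp add: commutator_def)
  then show ?thesis
    unfolding good_commutator_def by (intro exI[of _ 0]) (simp add: supported_def good_0)
next
  case False
  have "el 0 m m = 0" for m :: nat
    by (rule cfmat_eqI) simp
  with diag_minus_trace_commutator[OF assms(1) False, of t] assms(2) show ?thesis
    unfolding good_commutator_def by (metis diff_zero)
qed

section \<open>Upper triangular matrices of trace zero\<close>

lift_definition blockm :: "nat \<Rightarrow> (nat \<Rightarrow> nat \<Rightarrow> 'a) \<Rightarrow> 'a::ring_1 cfmat"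
  is "\<lambda>n f i j. if i < n \<and> j < n then f i j else 0"
  by simp

lemmas [simp] = blockm.rep_eq

definition upper :: "'a::ring_1 cfmat \<Rightarrow> bool" where
  "upper A \<longleftrightarrow> (\<forall>i j. j < i \<longrightarrow> ent A i j = 0)"

definition is_commutator :: "nat \<Rightarrow> 'a::ring_1 cfmat \<Rightarrow> bool" where
  "is_commutator n x \<longleftrightarrow> (\<exists>b c. supported {..<n} b \<and> supported {..<n} c \<and> x = commutator b c)"

text \<open>With \<open>b\<close> the upper shift, \<open>[b, c] = x\<close> reads \<open>c (i + 1) j - c i (j - 1) = x i j\<close>, which is
  solved along the diagonals.\<close>

lemma upper_trace_zero_is_commutator:
  assumes x: "supported {..<n} x" "upper x" and tr: "(\<Sum>k<n. ent x k k) = 0"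
  shows "is_commutator n x"
proof -
  \<comment> \<open>Unrolling the recursion gives partial sums of \<open>x\<close> along a diagonal.
    The guard keeps the natural subtraction exact; beyond it the sum would run below the main
    diagonal, where \<open>x\<close> vanishes.\<close>
  define g where "g i j = (if i \<le> Suc j then \<Sum>k<i. ent x k (Suc j + k - i) else 0)" for i j
  define b where "b = blockm n (\<lambda>i j. if j = Suc i then 1 else 0 :: 'a)"
  define c where "c = blockm n g"
  have bc: "ent (b * c) i j = (if Suc i < n \<and> j < n then g (Suc i) j else 0)" for i j
    unfolding b_def c_def by (subst ent_mult_left[where K = "{Suc i}"]) (auto split: if_splits)
  have cb: "ent (c * b) i j = (if i < n \<and> 0 < j \<and> j < n then g i (j - 1) else 0)" for i j
    unfolding b_def c_def by (subst ent_mult_superset[where K = "{j - 1}"]) (auto split: if_splits)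
  \<comment> \<open>Row \<open>n\<close> lies outside the block, so the recursion has to end in zero
    there; for \<open>j = n - 1\<close> this is the trace condition.\<close>
  have gn: "g n j = 0" if "j < n" for j
  proof (cases "n = Suc j")
    case True
    then show ?thesis
      using tr by (simp add: g_def)
  qed (use that in \<open>simp add: g_def\<close>)
  have rec: "g (Suc i) j = (if 0 < j then g i (j - 1) else 0) + ent x i j" for i j
    using x(2) by (cases j) (auto simp: g_def upper_def)
  have "x = commutator b c"
  proof (rule cfmat_eqI)
    fix i j
    show "ent x i j = ent (commutator b c) i j"
    proof (cases "i < n \<and> j < n")
      case True
      then have "(if Suc i < n then g (Suc i) j else 0) = g (Suc i) j"
        using gn by (metis Suc_lessI)
      with True show ?thesis
        using rec[of i j] by (simp add: commutator_def bc cb)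
    next
      case False
      then show ?thesis
        using x(1) by (auto simp: commutator_def bc cb supported_def)
    qed
  qed
  moreover have "supported {..<n} b" "supported {..<n} c"
    by (auto simp: b_def c_def supported_def)
  ultimately show ?thesis
    unfolding is_commutator_def by blast
qed

section \<open>Products of two commutators\<close>

definition two_commutators :: "nat \<Rightarrow> 'a::ring_1 cfmat \<Rightarrow> bool" where
  "two_commutators n A \<longleftrightarrow> (\<exists>x y. is_commutator n x \<and> is_commutator n y \<and> A = x * y)"

lemma good_commutator_imp_is_commutator: "good_commutator {..<n} x \<Longrightarrow> is_commutator n x"
  unfolding good_commutator_def is_commutator_def by blast

text \<open>Invertible matrices completed by ones outside \<open>I\<close> do not lie in the corner
  of \<open>I\<close>; commuting with \<open>idm I\<close> lets them act on it by
  multiplication.\<close>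

lemma supported_mult_commuting:
  assumes "idm I * P = P * idm I" "supported I A"
  shows "supported I (P * A)" "supported I (A * P)"
proof -
  have A: "idm I * A = A" "A * idm I = A"
    using assms(2) by (simp_all only: supported_iff)
  have "idm I * (P * A) = P * (idm I * A)" "A * P * idm I = A * idm I * P"
    by (simp_all only: assms(1) mult.assoc flip: mult.assoc[of "idm I"])
  then have "idm I * (P * A) = P * A" "A * P * idm I = A * P"
    by (simp_all only: A)
  moreover have "P * A * idm I = P * A" "idm I * (A * P) = A * P"
    by (simp_all only: A mult.assoc flip: mult.assoc[of "idm I"])
  ultimately show "supported I (P * A)" "supported I (A * P)"
    by (simp_all only: supported_iff simp_thms)
qed

lemma is_commutator_conj:
  assumes PQ: "P * Q = 1" "Q * P = 1" and P: "idm {..<n} * P = P * idm {..<n}"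
    and x: "is_commutator n x"
  shows "is_commutator n (P * x * Q)"
proof -
  obtain b c where bc: "supported {..<n} b" "supported {..<n} c" "x = commutator b c"
    using x unfolding is_commutator_def by blast
  have Q: "idm {..<n} * Q = Q * idm {..<n}"
    using inverse_commutes[OF P PQ(2,1)] .
  have QP: "Q * (P * v) = v" for v
    by (simp add: PQ(2) flip: mult.assoc)
  have PQ_mult: "P * u * Q * (P * v * Q) = P * (u * v) * Q" for u v
    by (simp add: mult.assoc QP)
  have "P * x * Q = commutator (P * b * Q) (P * c * Q)"
    by (simp only: bc(3) commutator_def PQ_mult left_diff_distrib right_diff_distrib)
  moreover have "supported {..<n} (P * u * Q)" if "supported {..<n} u" for u
    using supported_mult_commuting(2)[OF Q supported_mult_commuting(1)[OF P that]] .
  ultimately show ?thesis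
    unfolding is_commutator_def using bc(1,2) by (intro exI conjI)
qed

lemma two_commutators_conj:
  assumes PQ: "P * Q = 1" "Q * P = 1" and P: "idm {..<n} * P = P * idm {..<n}"
    and A: "two_commutators n (P * A * Q)"
  shows "two_commutators n A"
proof -
  obtain x y where xy: "is_commutator n x" "is_commutator n y" "P * A * Q = x * y"
    using A unfolding two_commutators_def by blast
  have Q: "idm {..<n} * Q = Q * idm {..<n}"
    using inverse_commutes[OF P PQ(2,1)] .
  have cancel: "Q * (P * u) = u" "P * (Q * u) = u" for u
    by (simp_all add: PQ flip: mult.assoc)
  have "A = Q * (P * A * Q) * P"
    by (simp add: mult.assoc cancel PQ)
  also have "\<dots> = (Q * x * P) * (Q * y * P)"
    unfolding xy by (simp add: mult.assoc cancel)
  finally show ?thesis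
    unfolding two_commutators_def using is_commutator_conj[OF PQ(2,1) Q] xy by blast
qed

lemma zero_diag_is_commutator:
  fixes x :: "'a::division_ring cfmat"
  assumes inf: "infinite (ring_center :: 'a set)"
    and x: "supported {..<n} x" "\<And>i. ent x i i = 0"
  shows "is_commutator n x"
proof -
  have "idm {} * x * idm {} = diagm (\<lambda>i. if i \<in> {} then 0 else 0)"
    by (rule cfmat_eqI) simp
  then have "good_commutator ({} \<union> {..<n}) x"
    using x diag_trace_zero_good_commutator[of "{}" "\<lambda>_. 0"]
    by (intro good_commutator_zero_diag_extension[OF inf]) auto
  then show ?thesis
    by (simp add: good_commutator_imp_is_commutator)
qed

section \<open>Products of a permutation matrix and an upper triangular matrix\<close>

lemma upper_diag_factor_trace_zero:
  fixes V :: "'a::division_ring cfmat"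
  assumes inf: "infinite (ring_center :: 'a set)" and n: "n \<ge> 2"
    and V: "upper V" "supported {..<n} V" "ent V 0 0 \<noteq> 0"
  obtains d y where "d 0 \<noteq> 0" "upper y" "supported {..<n} y" "diagm d * y = V"
    "(\<Sum>k<n. ent y k k) = 0"
proof (cases "ent V (n - 1) (n - 1) = 0")
  case True
  \<comment> \<open>The last row of \<open>V\<close> is zero, so a zero in \<open>d\<close> leaves
    the last diagonal entry of \<open>y\<close> free to be minus the trace of
    \<open>V\<close>.\<close>
  define d where "d i = (if i = n - 1 then 0 else 1 :: 'a)" for i
  define y where "y = V + el (- (\<Sum>k<n. ent V k k)) (n - 1) (n - 1)"
  have last: "ent V (n - 1) j = 0" for j
    using V True n by (cases j "n - 1" rule: linorder_cases) (auto simp: upper_def supported_def)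
  have "d 0 \<noteq> 0"
    using n by (simp add: d_def)
  moreover have "upper y" "supported {..<n} y"
    using V n by (auto simp: y_def upper_def supported_def)
  moreover have "diagm d * y = V"
    using last by (intro cfmat_eqI) (auto simp: y_def d_def)
  moreover have "(\<Sum>k<n. ent y k k) = 0"
    using n by (simp add: y_def sum.distrib)
  ultimately show ?thesis
    by (rule that)
next
  case False
  let ?v = "ent V (n - 1) (n - 1)"
  define w where "w = (\<Sum>k\<in>{1..<n - 1}. ent V k k)"
  have "infinite (UNIV :: 'a set)"
    using inf by (rule infinite_super[OF subset_UNIV])
  \<comment> \<open>Scaling the last row by \<open>t\<close> and the first row to diagonal entry
    \<open>s\<close> makes the trace \<open>s + t * ?v + w\<close>; the excluded values keep
    \<open>t\<close> and the resulting \<open>s\<close> nonzero.\<close>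
  then obtain t where "t \<notin> {0, - w * inverse ?v}"
    using ex_new_if_finite[of "{0, - w * inverse ?v}"] by auto
  then have t: "t \<noteq> 0" "t \<noteq> - w * inverse ?v"
    by simp_all
  define s where "s = - (t * ?v + w)"
  have s: "s \<noteq> 0"
  proof
    assume "s = 0"
    then have "t * ?v = - w"
      by (simp add: s_def) (metis minus_minus)
    then have "t * ?v * inverse ?v = - w * inverse ?v"
      by (simp only:)
    then have "t = - w * inverse ?v"
      by (simp only: mult.assoc right_inverse[OF False] mult_1_right)
    with t show False
      by blast
  qed
  define d where "d i = (if i = 0 then ent V 0 0 * inverse s else if i = n - 1 then inverse t else 1)" for i
  define y where "y = diagm (\<lambda>i. inverse (d i)) * V"
  have d: "d i \<noteq> 0" for i
    using V s t by (simp add: d_def)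
  have "{..<n} = {0, n - 1} \<union> {1..<n - 1}"
    using n by auto
  then have "(\<Sum>k<n. ent y k k) = (\<Sum>k\<in>{0, n - 1} \<union> {1..<n - 1}. ent y k k)"
    by (simp only:)
  also have "\<dots> = (\<Sum>k\<in>{0, n - 1}. ent y k k) + (\<Sum>k\<in>{1..<n - 1}. ent y k k)"
    using n by (intro sum.union_disjoint) auto
  also have "(\<Sum>k\<in>{1..<n - 1}. ent y k k) = w"
    unfolding w_def by (rule sum.cong) (auto simp: y_def d_def)
  also have "(\<Sum>k\<in>{0, n - 1}. ent y k k) = s + t * ?v"
    using n s t V by (simp add: y_def d_def nonzero_inverse_mult_distrib mult.assoc)
  finally have "(\<Sum>k<n. ent y k k) = 0"
    by (simp add: s_def)
  moreover have "diagm d * y = V"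
    unfolding y_def by (intro cfmat_eqI, simp) (simp add: d flip: mult.assoc)
  moreover have "upper y" "supported {..<n} y"
    using V by (auto simp: y_def upper_def supported_def)
  ultimately show ?thesis
    using d[of 0] by (intro that[of d y])
qed

text \<open>Writing \<open>V = D y\<close> with \<open>y\<close> of trace zero, \<open>permm p * V\<close> is the product of
  \<open>permm p * D * (1 + el \<rho> 0 (p 0))\<close> and \<open>(1 - el \<rho> 0 (p 0)) * y\<close>. The diagonal of the first
  factor consists of the \<open>d i\<close> at the fixed points of \<open>p\<close> and of a further entry at
  \<open>(p 0, p 0)\<close>, and \<open>\<rho>\<close> is chosen so that this entry brings the trace to zero.\<close>

lemma perm_upper_two_commutators:
  fixes V :: "'a::division_ring cfmat"
  assumes inf: "infinite (ring_center :: 'a set)"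
    and p: "p permutes {..<n}" "p 0 \<noteq> 0"
    and V: "upper V" "supported {..<n} V" "ent V 0 0 \<noteq> 0"
  shows "two_commutators n (permm p * V)"
proof -
  define r where "r = p 0"
  have "0 < n"
    using permutes_not_in[OF p(1), of 0] p(2) by (cases n) auto
  then have r: "r < n" "r \<noteq> 0"
    using p permutes_in_image[OF p(1), of 0] by (auto simp: r_def)
  then have "n \<ge> 2"
    by linarith
  then obtain d y where d0: "d 0 \<noteq> 0" and y: "upper y" "supported {..<n} y" "diagm d * y = V"
    and tr: "(\<Sum>k<n. ent y k k) = 0"
    by (rule upper_diag_factor_trace_zero[OF inf _ V])
  have inj: "inj p"
    using p(1) by (rule permutes_inj)
  define F where "F = {i. i < n \<and> p i = i}"
  have F: "finite F" "F \<subseteq> {..<n}" "r \<notin> F"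
    using inj r by (auto simp: F_def r_def inj_eq)
  define \<theta> where "\<theta> = - sum d F"
  \<comment> \<open>Under \<open>permm p * D\<close>, row \<open>0\<close> moves to row
    \<open>r\<close> with factor \<open>d 0\<close>; the factor \<open>inverse (d 0)\<close> leaves
    exactly \<open>\<theta>\<close> at \<open>(r, r)\<close>.\<close>
  define N where "N = el (inverse (d 0) * \<theta>) 0 r"
  define D where "D = diagm (\<lambda>i. if i < n then d i else 0)"
  define x where "x = permm p * D * (1 + N)"
  have NN: "N * N = 0"
    using r by (simp add: N_def el_mult_el)
  have Dy: "D * y = V"
    unfolding y(3)[symmetric] using y(2) by (intro cfmat_eqI) (auto simp: D_def supported_def)
  have "x * ((1 - N) * y) = permm p * D * ((1 + N) * (1 - N)) * y"
    by (simp add: x_def mult.assoc)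
  also have "(1 + N) * (1 - N) = 1"
    using NN by (simp add: algebra_simps)
  finally have prod: "permm p * V = x * ((1 - N) * y)"
    by (simp add: Dy mult.assoc)
  have entx: "ent x i j = (if i = p j \<and> j < n then d j else 0) + (if i = r \<and> j = r then \<theta> else 0)"
    for i j
    using d0 \<open>0 < n\<close> by (auto simp: x_def N_def D_def distrib_left r_def simp flip: mult.assoc)
  have "is_commutator n ((1 - N) * y)"
  proof (rule upper_trace_zero_is_commutator)
    \<comment> \<open>A multiple of row \<open>r\<close> is subtracted from row \<open>0\<close>; as
      \<open>0 < r\<close>, \<open>upper y\<close> gives \<open>ent y r 0 = 0\<close> and the trace
      is unchanged.\<close>
    have *: "ent ((1 - N) * y) i j = ent y i j - (if i = 0 then inverse (d 0) * \<theta> * ent y r j else 0)" for i j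
      by (simp add: left_diff_distrib N_def)
    show "supported {..<n} ((1 - N) * y)" "upper ((1 - N) * y)"
      using y(1,2) \<open>0 < n\<close> unfolding supported_def upper_def * by auto
    show "(\<Sum>k<n. ent ((1 - N) * y) k k) = 0"
      unfolding * using tr y(1) r by (simp add: upper_def sum_subtractf)
  qed
  moreover have "is_commutator n x"
  proof -
    define S where "S = insert r F"
    define t where "t i = (if i = r then \<theta> else d i)" for i
    have S: "finite S" "S \<union> ({..<n} - S) = {..<n}"
      using F r by (auto simp: S_def)
    have "sum t F = sum d F"
      using F by (intro sum.cong) (auto simp: t_def)
    then have "sum t S = 0"
      using F by (simp add: S_def t_def \<theta>_def)
    moreover have "idm S * x * idm S = diagm (\<lambda>i. if i \<in> S then t i else 0)"
    proof (rule cfmat_eqI)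
      fix i j
      \<comment> \<open>\<open>p r = r\<close> would contradict \<open>p 0 = r\<close> with
        \<open>r \<noteq> 0\<close>, and a fixed \<open>p r\<close> would give
        \<open>p r = r\<close> by injectivity. So \<open>x\<close> has no off-diagonal entry within
        \<open>S\<close>.\<close>
      have "p r \<notin> S"
        using inj r F unfolding S_def F_def r_def by (auto simp: inj_eq)
      then show "ent (idm S * x * idm S) i j = ent (diagm (\<lambda>i. if i \<in> S then t i else 0)) i j"
        using F r by (auto simp: entx S_def F_def t_def)
    qed
    ultimately have "good_commutator S (idm S * x * idm S)"
      using diag_trace_zero_good_commutator[OF S(1), of t] by simp
    moreover have "supported (S \<union> ({..<n} - S)) x"
      unfolding S(2) using r permutes_in_image[OF p(1)] by (auto simp: supported_def entx)
    moreover have "ent x i i = 0" if "i \<in> {..<n} - S" for i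
      using that by (auto simp: entx S_def F_def)
    ultimately have "good_commutator (S \<union> ({..<n} - S)) x"
      by (intro good_commutator_zero_diag_extension[OF inf]) auto
    then show ?thesis
      unfolding S(2) by (rule good_commutator_imp_is_commutator)
  qed
  ultimately show ?thesis
    unfolding two_commutators_def prod by blast
qed

section \<open>Bruhat decomposition\<close>

lemma upper_mult:
  assumes "upper A" "upper B"
  shows "upper (A * B)"
  unfolding upper_def
proof (intro allI impI)
  fix i j :: nat assume ij: "j < i"
  have "ent A i k * ent B k j = 0" for k
    using assms ij unfolding upper_def by (cases "j < k") (auto simp: order.strict_trans1)
  then show "ent (A * B) i j = 0"
    by (simp add: times_cfmat.rep_eq)
qed

lemma idm_permm_commute:
  assumes "p permutes {..<n}"
  shows "idm {..<n} * permm p = permm p * idm {..<n}"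
  using permutes_in_image[OF assms] by (intro cfmat_eqI) (auto split: if_splits)

lemma permm_mult_inverse:
  assumes "\<And>i. p (q i) = i"
  shows "permm p * permm q = 1"
  using assms by (intro cfmat_eqI) auto

text \<open>One column of the elimination behind the Bruhat decomposition: the pivot is the lowest
  nonzero entry among the rows \<open>p k, p (k + 1), \<dots>\<close>, so that it clears the others by upper
  triangular row operations.\<close>

lemma bruhat_step:
  fixes C :: "'a::division_ring cfmat"
  assumes p: "p permutes {..<n}" and C: "supported {..<n} C" and k: "k < n"
    and zero: "\<forall>i j. j < i \<longrightarrow> j < k \<longrightarrow> ent C (p i) j = 0"
  shows "\<exists>W W' q. W * W' = 1 \<and> W' * W = 1 \<and> upper W \<and> upper W' \<and>
    idm {..<n} * W = W * idm {..<n} \<and> q permutes {..<n} \<and>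
    (\<forall>i j. j < i \<longrightarrow> j < Suc k \<longrightarrow> ent (W * C) (q i) j = 0)"
proof -
  define R where "R = {p i |i. k \<le> i \<and> i < n \<and> ent C (p i) k \<noteq> 0}"
  have finR: "finite R"
    unfolding R_def by simp
  show ?thesis
  proof (cases "R = {}")
    case True
    have "ent C (p i) j = 0" if "j < i" "j < Suc k" for i j
    proof (cases "j < k")
      case False
      then have "j = k"
        using that by simp
      show ?thesis
      proof (cases "i < n")
        case True
        then show ?thesis
          using \<open>R = {}\<close> \<open>j = k\<close> that unfolding R_def by auto
      next
        case False
        then show ?thesis
          using C permutes_not_in[OF p, of i] by (simp add: supported_def)
      qed
    qed (use that zero in simp)
    then show ?thesis
      using p by (intro exI[of _ 1] exI[of _ p]) (simp add: upper_def)
  next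
    case False
    define \<rho> where "\<rho> = Max R"
    have "\<rho> \<in> R"
      unfolding \<rho>_def using finR False by (rule Max_in)
    then obtain i0 where i0: "\<rho> = p i0" "k \<le> i0" "i0 < n" and piv: "ent C \<rho> k \<noteq> 0"
      unfolding R_def by auto
    have \<rho>n: "\<rho> < n"
      using permutes_in_image[OF p, of i0] i0 by simp
    have lt: "l < \<rho>" if "l \<in> R - {\<rho>}" for l
      using Max_ge[OF finR, of l] that unfolding \<rho>_def by auto
    define f where "f l = (if l \<in> R - {\<rho>} then ent C l k * inverse (ent C \<rho> k) else 0)" for l
    \<comment> \<open>\<open>1 - u\<close> subtracts multiples of the pivot row. The pivot is
      lowest, so \<open>u\<close> is strictly upper triangular; also \<open>u * u = 0\<close>, so
      \<open>1 + u\<close> is the inverse.\<close>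
    define u where "u = blockm n (\<lambda>l j. if j = \<rho> then f l else 0)"
    have entu: "ent (u * A) l j = (if l < n then f l * ent A \<rho> j else 0)" for A l j
      unfolding u_def using \<rho>n by (subst ent_mult_left[where K = "{\<rho>}"]) (auto split: if_splits)
    have fn: "f l = 0" if "\<not> l < \<rho>" for l
      using lt that unfolding f_def by auto
    have uu: "u * u = 0"
      using fn[of \<rho>] by (intro cfmat_eqI) (simp add: entu, simp add: u_def)
    have up: "upper u"
      unfolding upper_def u_def using fn by auto
    have supp: "supported {..<n} u"
      by (auto simp: supported_def u_def)
    \<comment> \<open>The swap puts the pivot row at position \<open>k\<close>. Both swapped
      positions are at least \<open>k\<close>, so the columns already cleared stay cleared.\<close>
    define q where "q = p \<circ> transpose k i0"
    have "ent ((1 - u) * C) (q i) j = 0" if ij: "j < i" "j < Suc k" for i j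
    proof -
      have eq: "ent ((1 - u) * C) (q i) j
          = ent C (q i) j - (if q i < n then f (q i) * ent C \<rho> j else 0)"
        by (simp add: left_diff_distrib entu)
      show ?thesis
      proof (cases "j < k")
        case True
        have "j < transpose k i0 i"
          using True ij i0 by (auto simp: transpose_def)
        then have "ent C (q i) j = 0"
          using zero True by (simp add: q_def)
        moreover have "ent C \<rho> j = 0"
          using zero True i0 by simp
        ultimately show ?thesis
          by (simp add: eq)
      next
        case False
        then have j: "j = k" "k < i"
          using ij by auto
        let ?i = "transpose k i0 i"
        have i: "k \<le> ?i" "?i \<noteq> i0"
          using j i0 by (auto simp: transpose_def)
        then have neq: "q i \<noteq> \<rho>"
          using permutes_inj[OF p] by (auto simp: q_def i0(1) inj_eq)
        show ?thesis
        proof (cases "q i \<in> R")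
          case True
          then have "q i < n"
            using lt[of "q i"] neq \<rho>n by auto
          then show ?thesis
            unfolding eq unfolding j(1) using True neq piv by (simp add: f_def mult.assoc)
        next
          case False
          have "ent C (q i) k = 0"
          proof (cases "?i < n")
            case True
            then show ?thesis
              using False i(1) unfolding R_def q_def by auto
          next
            case False
            then show ?thesis
              using C permutes_not_in[OF p, of ?i] by (simp add: supported_def q_def)
          qed
          with False show ?thesis
            unfolding eq unfolding j(1) by (simp add: f_def)
        qed
      qed
    qed
    moreover have "q permutes {..<n}"
      unfolding q_def using p k i0 by (intro permutes_compose permutes_swap_id) auto
    moreover have "(1 - u) * (1 + u) = 1" "(1 + u) * (1 - u) = 1"
      using uu by (simp_all add: algebra_simps)
    moreover have "upper (1 - u)" "upper (1 + u)"
      using up by (auto simp: upper_def)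
    moreover have "idm {..<n} * (1 - u) = (1 - u) * idm {..<n}"
    proof -
      have "idm {..<n} * u = u" "u * idm {..<n} = u"
        using supp by (simp_all only: supported_iff)
      then show ?thesis
        by (simp add: algebra_simps)
    qed
    ultimately show ?thesis
      by (intro exI[of _ "1 - u"] exI[of _ "1 + u"] exI[of _ q]) simp
  qed
qed

text \<open>Columns are cleared one after another by \<open>bruhat_step\<close>. At
  \<open>k = n\<close>, permuting the rows of \<open>U * B\<close> by the inverse of
  \<open>p\<close> makes it upper triangular, which is the Bruhat decomposition of
  \<open>B\<close>.\<close>

lemma bruhat:
  fixes B :: "'a::division_ring cfmat"
  assumes B: "supported {..<n} B" and k: "k \<le> n"
  shows "\<exists>U U' p. U * U' = 1 \<and> U' * U = 1 \<and> upper U \<and> upper U' \<and>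
    idm {..<n} * U = U * idm {..<n} \<and> p permutes {..<n} \<and>
    (\<forall>i j. j < i \<longrightarrow> j < k \<longrightarrow> ent (U * B) (p i) j = 0)"
  using k
proof (induction k)
  case 0
  show ?case
    by (intro exI[of _ 1] exI[of _ id]) (simp add: upper_def permutes_id del: id_apply)
next
  case (Suc k)
  then obtain U U' p where U: "U * U' = 1" "U' * U = 1" "upper U" "upper U'"
      "idm {..<n} * U = U * idm {..<n}" and p: "p permutes {..<n}"
      and zero: "\<forall>i j. j < i \<longrightarrow> j < k \<longrightarrow> ent (U * B) (p i) j = 0"
    by auto
  have UB: "supported {..<n} (U * B)"
    using U(5) B by (rule supported_mult_commuting)
  have "k < n"
    using Suc.prems by simp
  from bruhat_step[of p n "U * B" k, OF p UB this zero] obtain W W' q where W: "W * W' = 1" "W' * W = 1"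
      "upper W" "upper W'" "idm {..<n} * W = W * idm {..<n}" and q: "q permutes {..<n}"
      "\<forall>i j. j < i \<longrightarrow> j < Suc k \<longrightarrow> ent (W * (U * B)) (q i) j = 0"
    by (elim exE conjE)
  have "W * U * (U' * W') = W * (U * U') * W'" "U' * W' * (W * U) = U' * (W' * W) * U"
    by (simp_all only: mult.assoc)
  then have inv: "W * U * (U' * W') = 1" "U' * W' * (W * U) = 1"
    by (simp_all only: U W mult_1_right)
  have comm: "idm {..<n} * (W * U) = W * U * idm {..<n}"
    by (simp only: mult.assoc U(5)[symmetric]) (simp only: W(5) flip: mult.assoc)
  show ?case
    using inv comm q U W upper_mult[OF W(3) U(3)] upper_mult[OF U(4) W(4)]
    by (intro exI[of _ "W * U"] exI[of _ "U' * W'"] exI[of _ q]) (simp add: mult.assoc)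
qed

text \<open>With \<open>B = U' * permm p * T\<close>, conjugation by \<open>U\<close> gives
  \<open>permm p * (T * U')\<close>, the form treated in \<open>perm_upper_two_commutators\<close>.
  The nonzero entry below the diagonal forces \<open>p 0 \<noteq> 0\<close>.\<close>

lemma two_commutators_of_column:
  fixes B :: "'a::division_ring cfmat"
  assumes inf: "infinite (ring_center :: 'a set)"
    and B: "supported {..<n} B" and r: "0 < r" "ent B r 0 \<noteq> 0"
  shows "two_commutators n B"
proof -
  obtain U U' p where U: "U * U' = 1" "U' * U = 1" and up: "upper U" "upper U'"
      and comm: "idm {..<n} * U = U * idm {..<n}" and p: "p permutes {..<n}"
      and zero: "\<And>i j. j < i \<Longrightarrow> j < n \<Longrightarrow> ent (U * B) (p i) j = 0"
    using bruhat[OF B order.refl] by auto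
  have comm': "idm {..<n} * U' = U' * idm {..<n}"
    by (rule inverse_commutes[OF comm U(2,1)])
  define q where "q = inv_into UNIV p"
  have pq: "p (q i) = i" "q (p i) = i" for i
    using permutes_inverses[OF p] by (simp_all add: q_def)
  have q: "q permutes {..<n}"
    unfolding q_def using p by (rule permutes_inv)
  have "0 < n"
    using B r by (cases n) (auto simp: supported_def)
  define C where "C = U * B"
  have C: "supported {..<n} C"
    unfolding C_def using comm B by (rule supported_mult_commuting)
  have "B = U' * C"
    by (simp add: C_def U flip: mult.assoc)
  have col: "ent C i 0 = 0" if "i \<noteq> p 0" for i
  proof -
    have "q i \<noteq> 0"
      using pq(1)[of i] that by metis
    then show ?thesis
      using zero[of 0 "q i"] \<open>0 < n\<close> by (simp add: C_def pq)
  qed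
  \<comment> \<open>Column \<open>0\<close> of \<open>B\<close> is a multiple of column
    \<open>p 0\<close> of \<open>U'\<close>; for \<open>p 0 = 0\<close> it would vanish below the
    diagonal.\<close>
  have "ent B i 0 = ent U' i (p 0) * ent C (p 0) 0" for i
    unfolding \<open>B = U' * C\<close> using col by (subst ent_mult_superset[where K = "{p 0}"]) auto
  then have "ent U' r (p 0) \<noteq> 0" "ent C (p 0) 0 \<noteq> 0"
    using r(2) by auto
  then have p0: "p 0 \<noteq> 0" "ent C (p 0) 0 \<noteq> 0"
    using r(1) up(2) unfolding upper_def by (cases "p 0 = 0"; auto)+
  define T where "T = permm q * C"
  have entT: "ent T i j = ent C (p i) j" for i j
    using ent_permm_mult[OF permutes_inj[OF q], of C "p i" j] by (simp add: T_def pq)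
  have T: "supported {..<n} T"
    unfolding T_def using idm_permm_commute[OF q] C by (rule supported_mult_commuting)
  have "upper T"
    unfolding upper_def
  proof (intro allI impI)
    fix i j :: nat assume "j < i"
    then show "ent T i j = 0"
      using zero[of j i] C by (cases "j < n") (auto simp: entT C_def supported_def)
  qed
  have V00: "ent (X * U') 0 0 = ent X 0 0 * ent U' 0 0" for X
    using up(2) by (subst ent_mult_superset[where K = "{0}"]) (auto simp: upper_def intro: ccontr)
  have "ent U' 0 0 \<noteq> 0"
    using V00[of U] U(1) by auto
  then have "ent (T * U') 0 0 \<noteq> 0"
    using p0 by (simp add: V00 entT)
  moreover have "supported {..<n} (T * U')"
    using comm' T by (rule supported_mult_commuting)
  ultimately have "two_commutators n (permm p * (T * U'))"
    using upper_mult[OF \<open>upper T\<close> up(2)] by (intro perm_upper_two_commutators[OF inf p p0(1)])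
  also have "permm p * (T * U') = permm p * permm q * (U * B * U')"
    by (simp add: T_def C_def mult.assoc)
  also have "\<dots> = U * B * U'"
    by (simp add: permm_mult_inverse[of p q] pq)
  finally show ?thesis
    by (rule two_commutators_conj[OF U comm])
qed

section \<open>Scalar matrices and the general case\<close>

lemma scalar_two_commutators:
  fixes s :: "'a::division_ring"
  assumes inf: "infinite (ring_center :: 'a set)" and n: "n \<ge> 2"
  shows "two_commutators n (blockm n (\<lambda>i j. if i = j then s else 0 :: 'a))"
proof -
  \<comment> \<open>\<open>x\<close> is a cyclic permutation matrix and \<open>y\<close> is
    \<open>s\<close> times its inverse; both have zero diagonal because
    \<open>n \<ge> 2\<close>.\<close>
  define x where "x = blockm n (\<lambda>i j. if i = Suc j mod n then 1 else 0 :: 'a)"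
  define y where "y = blockm n (\<lambda>i j. if j = Suc i mod n then s else 0)"
  have "Suc i mod n \<noteq> i" if "i < n" for i
    using that n by (cases "Suc i = n") auto
  then have ne: "i \<noteq> Suc i mod n" if "i < n" for i
    using that by fastforce
  have "is_commutator n x" "is_commutator n y"
    using ne by (auto intro!: zero_diag_is_commutator[OF inf] simp: x_def y_def supported_def)
  moreover have "x * y = blockm n (\<lambda>i j. if i = j then s else 0)"
  proof (rule cfmat_eqI)
    fix i j
    define k where "k = (if i = 0 then n - 1 else i - 1)"
    have k: "Suc l mod n = i \<longleftrightarrow> l = k" if "i < n" "l < n" for l
      using that n by (cases "Suc l = n") (auto simp: k_def)
    have "k < n" if "i < n"
      using that n by (auto simp: k_def)
    then show "ent (x * y) i j = ent (blockm n (\<lambda>i j. if i = j then s else 0)) i j"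
      using k by (subst ent_mult_left[where K = "{k}"])
        (auto simp: x_def y_def split: if_splits)
  qed
  ultimately show ?thesis
    unfolding two_commutators_def by metis
qed

text \<open>If all conjugates by the transvections below vanish in column \<open>0\<close> below the
  diagonal, comparing them shows that \<open>a\<close> is diagonal with constant diagonal, the case
  of \<open>scalar_two_commutators\<close>.\<close>

lemma all_two_commutators:
  fixes a :: "'a::division_ring cfmat"
  assumes inf: "infinite (ring_center :: 'a set)" and n: "n \<ge> 2" and a: "supported {..<n} a"
  shows "two_commutators n a"
proof (rule ccontr)
  assume not: "\<not> two_commutators n a"
  \<comment> \<open>The left-hand side is the entry \<open>(r, 0)\<close> of the conjugate of
    \<open>a\<close> by \<open>1 - el s j 0\<close>, of degree at most two in
    \<open>s\<close>.\<close>
  have *: "ent a r 0 + ent a r j * s - (if r = j then s * (ent a 0 0 + ent a 0 j * s) else 0) = 0"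
    if j: "0 < j" "j < n" and r: "0 < r" for j r s
  proof -
    let ?N = "el s j 0"
    have NN: "?N * ?N = 0"
      using j by (simp add: el_mult_el)
    have inv: "(1 - ?N) * (1 + ?N) = 1" "(1 + ?N) * (1 - ?N) = 1"
      using NN by (simp_all add: algebra_simps)
    have comm: "idm {..<n} * (1 - ?N) = (1 - ?N) * idm {..<n}"
      "idm {..<n} * (1 + ?N) = (1 + ?N) * idm {..<n}"
      using j by (auto intro!: cfmat_eqI simp: distrib_left distrib_right left_diff_distrib right_diff_distrib)
    have "supported {..<n} ((1 - ?N) * a * (1 + ?N))"
      using comm(2) supported_mult_commuting(1)[OF comm(1) a] by (rule supported_mult_commuting)
    moreover have "\<not> two_commutators n ((1 - ?N) * a * (1 + ?N))"
      using not two_commutators_conj[OF inv comm(1)] by blast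
    ultimately have "ent ((1 - ?N) * a * (1 + ?N)) r 0 = 0"
      using two_commutators_of_column[OF inf _ r] by blast
    then show ?thesis
      using j by (simp add: distrib_left left_diff_distrib algebra_simps split: if_splits)
  qed
  \<comment> \<open>Comparing \<open>s = 1\<close> with a further value \<open>z\<close> isolates
    the quadratic term; centrality of \<open>z\<close> lets it be cancelled on the left.\<close>
  have "\<not> ring_center \<subseteq> {0, 1 :: 'a}"
    using inf finite_subset[of ring_center "{0, 1 :: 'a}"] by auto
  then obtain z :: 'a where z: "z \<in> ring_center" "z \<noteq> 0" "z \<noteq> 1"
    by auto
  have r0: "ent a r 0 = 0" if "0 < r" for r
    using *[of 1 r 0] n that by simp
  have off: "ent a r j = 0" if "0 < j" "j < n" "0 < r" "r \<noteq> j" for r j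
    using *[of j r 1] r0 that by simp
  have jj: "ent a j j * s = s * (ent a 0 0 + ent a 0 j * s)" if "0 < j" "j < n" for j s
    using *[of j j s] r0 that by simp
  have zj: "ent a 0 j = 0" if j: "0 < j" "j < n" for j
  proof -
    have "z * ent a j j = z * (ent a 0 0 + ent a 0 j * z)"
      using jj[OF j, of z] by (simp only: ring_centerD[OF z(1), of "ent a j j"])
    then have "ent a 0 0 + ent a 0 j = ent a 0 0 + ent a 0 j * z"
      using jj[OF j, of 1] z(2) by simp
    then have "ent a 0 j * (z - 1) = 0"
      by (simp add: right_diff_distrib)
    then show ?thesis
      using z(3) by simp
  qed
  have diag: "ent a j j = ent a 0 0" if "j < n" for j
    using jj[of j 1] zj[of j] that by (cases "j = 0") auto
  have "ent a i j = ent (blockm n (\<lambda>i j. if i = j then ent a 0 0 else 0)) i j" for i j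
  proof (cases "i < n \<and> j < n")
    case True
    then have "i = j \<or> ent a i j = 0"
      using r0[of i] off[of j i] zj[of j] by (cases "i = 0"; cases "j = 0") auto
    then show ?thesis
      using True diag[of j] by auto
  next
    case False
    then show ?thesis
      using a by (auto simp: supported_def)
  qed
  then have "a = blockm n (\<lambda>i j. if i = j then ent a 0 0 else 0)"
    by (rule cfmat_eqI)
  then show False
    using not scalar_two_commutators[OF inf n, of "ent a 0 0"] by simp
qed

section \<open>Return to matrices of fixed size\<close>

definition mat_of :: "nat \<Rightarrow> 'a::ring_1 cfmat \<Rightarrow> 'a mat" where
  "mat_of n A = mat n n (\<lambda>(i, j). ent A i j)"

lemma mat_of_carrier: "mat_of n A \<in> carrier_mat n n"
  by (simp add: mat_of_def)

lemma mat_of_mult: "supported {..<n} A \<Longrightarrow> mat_of n (A * B) = mat_of n A * mat_of n B"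
proof (rule eq_matI)
  fix i j assume A: "supported {..<n} A"
    and "i < dim_row (mat_of n A * mat_of n B)" "j < dim_col (mat_of n A * mat_of n B)"
  then have ij: "i < n" "j < n"
    by (simp_all add: mat_of_def)
  have "ent (A * B) i j = (\<Sum>k\<in>{..<n}. ent A i k * ent B k j)"
    using A by (intro ent_mult_left) (auto simp: supported_def intro: ccontr)
  then show "mat_of n (A * B) $$ (i, j) = (mat_of n A * mat_of n B) $$ (i, j)"
    using ij by (simp add: mat_of_def scalar_prod_def atLeast0LessThan)
qed (simp_all add: mat_of_def)

lemma mat_of_commutator:
  fixes A :: "'a::ring_1 cfmat"
  assumes "supported {..<n} A" "supported {..<n} B"
  shows "mat_of n (commutator A B) = commutator (mat_of n A) (mat_of n B)"
proof -
  have "mat_of n (X - Y) = mat_of n X - mat_of n Y" for X Y :: "'a cfmat"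
    by (rule eq_matI) (simp_all add: mat_of_def)
  then show ?thesis
    using assms by (simp add: commutator_def mat_of_mult)
qed

theorem theoremC:
  fixes n :: nat and a :: "'d :: division_ring mat"
  assumes "infinite (ring_center :: 'd set)"
    and "n \<ge> 2"
    and "a \<in> carrier_mat n n"
  shows "\<exists>b \<in> carrier_mat n n. \<exists>c \<in> carrier_mat n n.
         \<exists>d \<in> carrier_mat n n. \<exists>e \<in> carrier_mat n n.
           a = commutator b c * commutator d e"
proof -
  define A where "A = blockm n (\<lambda>i j. a $$ (i, j))"
  have "supported {..<n} A"
    by (auto simp: A_def supported_def)
  then have "two_commutators n A"
    by (rule all_two_commutators[OF assms(1,2)])
  then obtain b c d e where supp: "supported {..<n} b" "supported {..<n} c"
      "supported {..<n} d" "supported {..<n} e" and A: "A = commutator b c * commutator d e"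
    unfolding two_commutators_def is_commutator_def by auto
  have "a = mat_of n A"
    using assms(3) by (intro eq_matI) (auto simp: A_def mat_of_def)
  also have "\<dots> = commutator (mat_of n b) (mat_of n c) * commutator (mat_of n d) (mat_of n e)"
    unfolding A using supp by (simp add: mat_of_mult mat_of_commutator supported_commutator)
  finally show ?thesis
    using mat_of_carrier by (intro bexI)
qed

end
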